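(* Let $X$ be an infinite-dimensional Fréchet space. Then the set $$\mathcal{L}(X) \setminus \left(\mathcal{DR}(X) \cup \mathcal{CYC}(X) \cup \mathcal{INJ}(X)\right)$$ is SOT-spaceable in $\mathcal{L}(X)$; that is, there exists an infinite-dimensional vector subspace $V$ of $\mathcal{L}(X)$, closed in $\mathcal{L}(X)$ for the strong operator topology, such that every nonzero $T \in V$ is not of dense range, not cyclic and not injective.
   Context: All topological vector spaces are Hausdorff and over the field $\mathbb{K} = \mathbb{R}$ or $\mathbb{C}$. A Fréchet space is a locally convex, complete, metrizable topological vector space. $\mathcal{L}(X)$ is the vector space of all continuous linear operators $X \to X$. An operator $T \in \mathcal{L}(X)$ is cyclic if there is $x_0 \in X$ such that $\mathrm{span}\{T^n x_0 : n \ge 0\}$ is dense in $X$. Notation: $\mathcal{CYC}(X)$, $\mathcal{DR}(X)$, $\mathcal{INJ}(X)$ are the sets of $T \in \mathcal{L}(X)$ that are cyclic, have dense range, are injective, respectively. The strong operator topology (SOT) on $\mathcal{L}(X)$ is the topology of pointwise convergence: a net $(T_\alpha)$ converges to $T$ iff $T_\alpha(x) \to T(x)$ in $X$ for every $x \in X$. A subset $A$ of a topological vector space $E$ is spaceable if there is a closed infinite-dimensional vector subspace $V \subset E$ with $V \subset A \cup \{0\}$; SOT-spaceable means spaceable in $E = \mathcal{L}(X)$ with the SOT. *)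

theory Defs
  imports "HOL-Analysis.Analysis" "HOL-Library.Function_Algebras"
begin

text \<open>
  The scalar multiplication is an explicit parameter, because there is no type class of complex
  vector spaces. The sort \<open>real_normed_field\<close> only serves to treat the scalar fields \<open>real\<close> and
  \<open>complex\<close> uniformly. Since \<open>convex\<close> is tied to the class \<open>real_vector\<close>, convexity is spelled out
  in terms of the given scalar multiplication.

  In the class \<open>uniform_topological_group_add\<close> addition and negation are uniformly
  continuous, so the uniformity is necessarily the canonical one of the topological group, in which
  \<open>x\<close> and \<open>y\<close> are close iff \<open>x - y\<close> is close to \<open>0\<close>. Hence \<open>complete UNIV\<close> is completeness in the sense
  of topological vector spaces.
\<close>

locale topological_vector_space = vector_space scl
  for scl :: "'k::real_normed_field \<Rightarrow>
    'a::{uniform_topological_group_add, topological_ab_group_add, t2_space} \<Rightarrow> 'a" +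
  assumes continuous_on_scale: "continuous_on UNIV (\<lambda>(c, x). scl c x)"

definition convex_wrt :: "('k::real_normed_field \<Rightarrow> 'a::ab_group_add \<Rightarrow> 'a) \<Rightarrow> 'a set \<Rightarrow> bool" where
  "convex_wrt scl C \<longleftrightarrow> (\<forall>x\<in>C. \<forall>y\<in>C. \<forall>u\<ge>0. \<forall>v\<ge>0. u + v = 1 \<longrightarrow>
     scl (of_real u) x + scl (of_real v) y \<in> C)"

locale frechet_space = topological_vector_space scl
  for scl :: "'k::real_normed_field \<Rightarrow>
    'a::{uniform_topological_group_add, topological_ab_group_add, t2_space} \<Rightarrow> 'a" +
  assumes locally_convex:
      "\<And>U. open U \<Longrightarrow> 0 \<in> U \<Longrightarrow> \<exists>C. open C \<and> 0 \<in> C \<and> convex_wrt scl C \<and> C \<subseteq> U"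
    and metrizable: "metrizable_space (euclidean :: 'a topology)"
    and complete_UNIV: "complete (UNIV :: 'a set)"

definition infinite_dimensional ::
  "('k::field \<Rightarrow> 'v::ab_group_add \<Rightarrow> 'v) \<Rightarrow> 'v set \<Rightarrow> bool" where
  "infinite_dimensional scl V \<longleftrightarrow> (\<nexists>B. finite B \<and> module.span scl B = V)"

definition spaceable ::
  "('k::field \<Rightarrow> 'v::ab_group_add \<Rightarrow> 'v) \<Rightarrow> 'v topology \<Rightarrow> 'v set \<Rightarrow> bool" where
  "spaceable scl E A \<longleftrightarrow> (\<exists>V. module.subspace scl V \<and> closedin E V \<and>
     infinite_dimensional scl V \<and> V \<subseteq> A \<union> {0})"

definition continuous_operators ::
  "('k::field \<Rightarrow> 'a::{topological_space, ab_group_add} \<Rightarrow> 'a) \<Rightarrow> ('a \<Rightarrow> 'a) set" where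
  "continuous_operators scl =
     {T. Vector_Spaces.linear scl scl T \<and> continuous_on UNIV T}"

definition operator_scale :: "('k \<Rightarrow> 'a \<Rightarrow> 'a) \<Rightarrow> 'k \<Rightarrow> ('a \<Rightarrow> 'a) \<Rightarrow> 'a \<Rightarrow> 'a" where
  "operator_scale scl c T = (\<lambda>x. scl c (T x))"

text \<open>The library topology on functions is the product topology, that is, pointwise convergence.\<close>

definition strong_operator_top ::
  "('k::field \<Rightarrow> 'a::{topological_space, ab_group_add} \<Rightarrow> 'a) \<Rightarrow> ('a \<Rightarrow> 'a) topology" where
  "strong_operator_top scl = top_of_set (continuous_operators scl)"

definition dense_range_operators ::
  "('k::field \<Rightarrow> 'a::{topological_space, ab_group_add} \<Rightarrow> 'a) \<Rightarrow> ('a \<Rightarrow> 'a) set" where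
  "dense_range_operators scl = {T \<in> continuous_operators scl. closure (range T) = UNIV}"

definition cyclic_operators ::
  "('k::field \<Rightarrow> 'a::{topological_space, ab_group_add} \<Rightarrow> 'a) \<Rightarrow> ('a \<Rightarrow> 'a) set" where
  "cyclic_operators scl = {T \<in> continuous_operators scl.
     \<exists>x\<^sub>0. closure (module.span scl (range (\<lambda>n. (T ^^ n) x\<^sub>0))) = UNIV}"

definition injective_operators ::
  "('k::field \<Rightarrow> 'a::{topological_space, ab_group_add} \<Rightarrow> 'a) \<Rightarrow> ('a \<Rightarrow> 'a) set" where
  "injective_operators scl = {T \<in> continuous_operators scl. inj T}"

text \<open>
  The constants \<open>module.span\<close> and \<open>module.subspace\<close> are meaningful on the space of operators:
\<close>

lemma vector_space_operator_scale:
  assumes "vector_space scl"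
  shows "vector_space (operator_scale scl)"
proof -
  interpret vector_space scl by fact
  show ?thesis
    by unfold_locales
      (auto simp: operator_scale_def fun_eq_iff scale_right_distrib scale_left_distrib)
qed

lemma subspace_continuous_operators:
  assumes "topological_vector_space scl"
  shows "module.subspace (operator_scale scl) (continuous_operators scl)"
proof -
  interpret topological_vector_space scl by fact
  interpret op: vector_space "operator_scale scl"
    by (rule vector_space_operator_scale) unfold_locales
  interpret pair: vector_space_pair scl scl by unfold_locales
  have "continuous_on UNIV (\<lambda>x. scl c (T x))" if "continuous_on UNIV T" for c T
  proof -
    have "continuous_on UNIV (\<lambda>x. (c, T x))"
      using that by (intro continuous_intros)
    then have "continuous_on UNIV (\<lambda>x. case (c, T x) of (c, x) \<Rightarrow> scl c x)"
      by (rule continuous_on_compose2[OF continuous_on_scale]) auto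
    then show ?thesis by simp
  qed
  then show ?thesis
    unfolding op.subspace_def continuous_operators_def
    by (auto simp: operator_scale_def plus_fun_def zero_fun_def
        intro!: continuous_intros pair.linear_compose_add pair.linear_compose_scale_right pair.linear_zero)
qed

end

theory Submission
  imports Defs
begin

text \<open>
  Fix a continuous functional \<open>f\<close> and a point \<open>e\<close> with \<open>f e = 1\<close>. The rank one operators
  \<open>f \<otimes> w\<close>, where \<open>w\<close> ranges over the space, are the continuous operators \<open>T\<close> such that
  \<open>T x = f x \<sqdot> T e\<close> for all \<open>x\<close>, which is a closed condition. The range of \<open>f \<otimes> w\<close> and the orbits
  of \<open>f \<otimes> w\<close> span spaces of dimension at most one and two; such spaces are closed and proper.

  The functional comes from Hahn and Banach: by Zorn's lemma there is a minimal sublinear functional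
  below the Minkowski functional of a convex neighbourhood of \<open>0\<close>, and minimality makes it linear.
\<close>

lemma (in vector_space_pair) linearI:
  assumes "\<And>x y. f (x + y) = f x + f y" and "\<And>c x. f (s1 c x) = s2 c (f x)"
  shows "Vector_Spaces.linear s1 s2 f"
  using assms vs1.vector_space_axioms vs2.vector_space_axioms by (simp add: Vector_Spaces.linear_iff)

section \<open>Sublinear functionals\<close>

text \<open>Homogeneity is asked for positive factors only; \<open>p 0 = 0\<close> follows in a
  vector space by doubling the zero vector.\<close>

definition sublinear :: "(real \<Rightarrow> 'a \<Rightarrow> 'a) \<Rightarrow> ('a::ab_group_add \<Rightarrow> real) \<Rightarrow> bool" where
  "sublinear scl p \<longleftrightarrow> (\<forall>x y. p (x + y) \<le> p x + p y) \<and> (\<forall>t>0. \<forall>x. p (scl t x) = t * p x)"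

lemma sublinear_add: "sublinear scl p \<Longrightarrow> p (x + y) \<le> p x + p y"
  by (simp add: sublinear_def)

lemma sublinear_scale: "sublinear scl p \<Longrightarrow> t > 0 \<Longrightarrow> p (scl t x) = t * p x"
  by (simp add: sublinear_def)

locale real_vector_space = vector_space scl
  for scl :: "real \<Rightarrow> 'a::ab_group_add \<Rightarrow> 'a"
begin

text \<open>The missing inequality is the given one for \<open>inverse t\<close> and
  \<open>scl t x\<close>. One-sided bounds are what infima provide.\<close>

lemma sublinearI:
  assumes add: "\<And>x y. p (x + y) \<le> p x + p y"
    and scale: "\<And>t x. t > 0 \<Longrightarrow> p (scl t x) \<le> t * p x"
  shows "sublinear scl p"
proof -
  have "t * p x \<le> p (scl t x)" if "t > 0" for t x
    using scale[of "inverse t" "scl t x"] that by (simp add: field_simps)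
  with assms show ?thesis
    unfolding sublinear_def by (meson antisym)
qed

lemma sublinear_zero:
  assumes "sublinear scl p"
  shows "p 0 = 0"
  using sublinear_scale[OF assms, of 2 0] by simp

lemma sublinear_minus:
  assumes "sublinear scl p"
  shows "- p (- x) \<le> p x"
  using sublinear_add[OF assms, of x "- x"] sublinear_zero[OF assms] by simp

text \<open>Lowers \<open>p\<close> along the ray of \<open>y\<close>: in the infimum
  \<open>q\<close>, the parameter \<open>t = 0\<close> gives \<open>q \<le> p\<close>, and
  \<open>t = 1\<close> at \<open>- y\<close> gives the last claim.\<close>

lemma sublinear_decrease:
  assumes p: "sublinear scl p"
  obtains q where "sublinear scl q" "q \<le> p" "q (- y) \<le> - p y"
proof
  define q where "q x = (INF t\<in>{0..}. p (x + scl t y) - t * p y)" for x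
  have homogeneous: "p (scl t x) = t * p x" if "t \<ge> 0" for t x
    using that sublinear_scale[OF p, of t x] sublinear_zero[OF p] by (cases "t = 0") auto
  \<comment> \<open>Splitting \<open>scl t y\<close> as \<open>(x + scl t y) + (- x)\<close> bounds
    the family below, so \<open>Inf\<close> is a true infimum.\<close>
  have "- p (- x) \<le> p (x + scl t y) - t * p y" if "t \<ge> 0" for x t
    using sublinear_add[OF p, of "x + scl t y" "- x"] homogeneous[OF that, of y] by simp
  then have "bdd_below ((\<lambda>t. p (x + scl t y) - t * p y) ` {0..})" for x
    by (intro bdd_belowI2[where m = "- p (- x)"]) auto
  then have lower: "q x \<le> p (x + scl t y) - t * p y" if "t \<ge> 0" for x t
    using that unfolding q_def by (intro cINF_lower) auto
  have greatest: "m \<le> q x" if "\<And>t. t \<ge> 0 \<Longrightarrow> m \<le> p (x + scl t y) - t * p y" for m x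
    using that unfolding q_def by (intro cINF_greatest) auto
  show "sublinear scl q"
  proof (rule sublinearI)
    fix x z
    have *: "q (x + z) \<le> (p (x + scl s y) - s * p y) + (p (z + scl t y) - t * p y)"
      if "s \<ge> 0" "t \<ge> 0" for s t
      using lower[of "s + t" "x + z"] sublinear_add[OF p, of "x + scl s y" "z + scl t y"] that
      by (simp add: algebra_simps)
    \<comment> \<open>The two infima are taken one after the other, first over \<open>t\<close>,
      then over \<open>s\<close>.\<close>
    have "q (x + z) - (p (x + scl s y) - s * p y) \<le> q z" if "s \<ge> 0" for s
      using *[OF that] by (intro greatest) (simp add: algebra_simps)
    then have "q (x + z) - q z \<le> q x"
      by (intro greatest) (simp add: algebra_simps)
    then show "q (x + z) \<le> q x + q z" by simp
  next
    fix s x assume s: "(s::real) > 0"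
    have "q (scl s x) / s \<le> p (x + scl t y) - t * p y" if "t \<ge> 0" for t
    proof -
      have "q (scl s x) \<le> p (scl s (x + scl t y)) - (s * t) * p y"
        using lower[of "s * t" "scl s x"] that s by (simp add: scale_right_distrib)
      also have "\<dots> = s * (p (x + scl t y) - t * p y)"
        using sublinear_scale[OF p s, of "x + scl t y"] by (simp only: right_diff_distrib mult.assoc)
      finally show ?thesis
        using s by (simp add: field_simps)
    qed
    then have "q (scl s x) / s \<le> q x"
      by (rule greatest)
    then show "q (scl s x) \<le> s * q x"
      using s by (simp add: field_simps)
  qed
  show "q \<le> p"
    using lower[of 0] by (simp add: le_fun_def)
  show "q (- y) \<le> - p y"
    using lower[of 1 "- y"] sublinear_zero[OF p] by simp
qed

text \<open>The pointwise infimum works. Subadditivity needs the chain: two members dominate a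
  common member \<open>s\<close>, whose own subadditivity is used.\<close>

lemma sublinear_chain_Inf:
  assumes "C \<noteq> {}"
    and sublinear: "\<And>p. p \<in> C \<Longrightarrow> sublinear scl p"
    and bound: "\<And>p. p \<in> C \<Longrightarrow> p \<le> p0"
    and chain: "\<And>p q. p \<in> C \<Longrightarrow> q \<in> C \<Longrightarrow> p \<le> q \<or> q \<le> p"
  obtains q where "sublinear scl q" "\<And>p. p \<in> C \<Longrightarrow> q \<le> p"
proof
  define q where "q x = (INF p\<in>C. p x)" for x
  have "- p0 (- x) \<le> p x" if "p \<in> C" for p x
    using sublinear_minus[OF sublinear[OF that], of x] bound[OF that]
    by (smt (verit) le_fun_def)
  then have "bdd_below ((\<lambda>p. p x) ` C)" for x
    by (intro bdd_belowI2[where m = "- p0 (- x)"]) auto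
  then have lower: "q x \<le> p x" if "p \<in> C" for x p
    using that unfolding q_def by (intro cINF_lower) auto
  have greatest: "m \<le> q x" if "\<And>p. p \<in> C \<Longrightarrow> m \<le> p x" for m x
    using that \<open>C \<noteq> {}\<close> unfolding q_def by (intro cINF_greatest) auto
  show "q \<le> p" if "p \<in> C" for p
    using lower[OF that] by (simp add: le_fun_def)
  show "sublinear scl q"
  proof (rule sublinearI)
    fix x y
    have *: "q (x + y) \<le> p x + r y" if pr: "p \<in> C" "r \<in> C" for p r
    proof -
      obtain s where s: "s \<in> C" "s \<le> p" "s \<le> r"
        using chain[OF pr] pr by auto
      have "q (x + y) \<le> s x + s y"
        using lower[OF s(1)] sublinear_add[OF sublinear[OF s(1)]] by (rule order_trans)
      also have "\<dots> \<le> p x + r y"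
        using s(2,3) by (intro add_mono) (auto simp: le_fun_def)
      finally show ?thesis .
    qed
    have "q (x + y) - p x \<le> q y" if "p \<in> C" for p
      using *[OF that] by (intro greatest) (simp add: algebra_simps)
    then have "q (x + y) - q y \<le> q x"
      by (intro greatest) (simp add: algebra_simps)
    then show "q (x + y) \<le> q x + q y" by simp
  next
    fix s x assume s: "(s::real) > 0"
    have "q (scl s x) / s \<le> p x" if "p \<in> C" for p
      using lower[OF that, of "scl s x"] sublinear_scale[OF sublinear[OF that] s] s
      by (simp add: field_simps)
    then have "q (scl s x) / s \<le> q x"
      by (rule greatest)
    then show "q (scl s x) \<le> s * q x"
      using s by (simp add: field_simps)
  qed
qed

text \<open>By minimality \<open>sublinear_decrease\<close> cannot lower \<open>p\<close>, so
  \<open>p\<close> is odd; an odd sublinear functional is linear.\<close>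

lemma minimal_sublinear_linear:
  assumes p: "sublinear scl p"
    and minimal: "\<And>q. sublinear scl q \<Longrightarrow> q \<le> p \<Longrightarrow> q = p"
  shows "Vector_Spaces.linear scl (*) p"
proof -
  interpret vector_space_pair scl "(*)" by unfold_locales
  have minus: "p (- y) = - p y" for y
  proof -
    obtain q where "sublinear scl q" "q \<le> p" "q (- y) \<le> - p y"
      using sublinear_decrease[OF p] .
    then show ?thesis
      using minimal[of q] sublinear_minus[OF p, of y] by simp
  qed
  show ?thesis
  proof (rule linearI)
    fix x y show "p (x + y) = p x + p y"
      \<comment> \<open>The reverse inequality comes from writing \<open>x\<close> as
        \<open>(x + y) + (- y)\<close>.\<close>
      using sublinear_add[OF p, of x y] sublinear_add[OF p, of "x + y" "- y"] minus[of y] by simp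
  next
    fix t x show "p (scl t x) = t * p x"
      using sublinear_scale[OF p, of t x] sublinear_scale[OF p, of "- t" x] sublinear_zero[OF p]
        minus[of "scl t x"]
      by (cases t "0::real" rule: linorder_cases) auto
  qed
qed

text \<open>Zorn's lemma is applied below a \<open>p'\<close> already lowered at \<open>- y\<close>:
  every \<open>f\<close> under \<open>p'\<close> has \<open>f (- y) \<le> - p y\<close>, which
  forces \<open>p y \<le> f y\<close>.\<close>

theorem Hahn_Banach_sublinear:
  assumes p: "sublinear scl p"
  obtains f where "Vector_Spaces.linear scl (*) f" "f \<le> p" "p y \<le> f y"
proof -
  obtain p' where p': "sublinear scl p'" "p' \<le> p" "p' (- y) \<le> - p y"
    using sublinear_decrease[OF p] .
  define A where "A = {q. sublinear scl q \<and> q \<le> p'}"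
  \<comment> \<open>Zorn yields maximal elements, so the order is reversed to get a minimal
    one.\<close>
  have "\<exists>f\<in>A. \<forall>q\<in>A. q \<le> f \<longrightarrow> q = f"
  proof (rule predicate_Zorn)
    show "partial_order_on A (relation_of (\<lambda>x y. y \<le> x) A)"
      by (rule partial_order_on_relation_ofI) auto
  next
    fix C assume C: "C \<in> Chains (relation_of (\<lambda>x y. y \<le> x) A)"
    then have sub: "C \<subseteq> A"
      by (auto simp: Chains_def relation_of_def)
    show "\<exists>u\<in>A. \<forall>a\<in>C. u \<le> a"
    proof (cases "C = {}")
      case True
      then show ?thesis
        using p' by (auto simp: A_def)
    next
      case False
      then obtain q where q: "sublinear scl q" "\<And>r. r \<in> C \<Longrightarrow> q \<le> r"
      proof (rule sublinear_chain_Inf[where ?p0.0 = p'])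
        show "r \<le> s \<or> s \<le> r" if "r \<in> C" "s \<in> C" for r s
          using C that by (auto simp: Chains_def relation_of_def)
      qed (use sub in \<open>auto simp: A_def\<close>)
      obtain r where "r \<in> C"
        using False by auto
      then have "q \<le> p'"
        using q(2)[of r] sub by (auto simp: A_def)
      then show ?thesis
        using q by (auto simp: A_def)
    qed
  qed
  then obtain f where f: "sublinear scl f" "f \<le> p'"
    and minimal: "\<And>q. sublinear scl q \<Longrightarrow> q \<le> p' \<Longrightarrow> q \<le> f \<Longrightarrow> q = f"
    by (auto simp: A_def)
  \<comment> \<open>Whatever lies below \<open>f\<close> also lies below \<open>p'\<close>, so
    minimality in \<open>A\<close> is minimality among all sublinear functionals.\<close>
  have "Vector_Spaces.linear scl (*) f"
    using f minimal by (intro minimal_sublinear_linear) auto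
  moreover have "f \<le> p"
    using f(2) p'(2) by simp
  moreover have "f (- y) \<le> - p y"
    using f(2) p'(3) by (auto simp: le_fun_def intro: order_trans)
  then have "p y \<le> f y"
    using sublinear_minus[OF f(1), of y] by simp
  ultimately show ?thesis
    by (rule that)
qed

end

section \<open>Separation of points by continuous functionals\<close>

definition continuous_functionals ::
  "('k::real_normed_field \<Rightarrow> 'a::{topological_space, ab_group_add} \<Rightarrow> 'a) \<Rightarrow> ('a \<Rightarrow> 'k) set" where
  "continuous_functionals scl = {f. Vector_Spaces.linear scl (*) f \<and> continuous_on UNIV f}"

context topological_vector_space
begin

lemma continuous_on_scl [continuous_intros]:
  assumes "continuous_on S c" "continuous_on S g"
  shows "continuous_on S (\<lambda>x. scl (c x) (g x))"
  using continuous_on_compose2[OF continuous_on_scale continuous_on_Pair[OF assms]] by simp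

end

text \<open>The gauge of \<open>C\<close>: openness at \<open>0\<close> makes it finite, convexity
  makes it subadditive.\<close>

lemma Minkowski_functional:
  fixes scl :: "real \<Rightarrow> 'a::{uniform_topological_group_add, topological_ab_group_add, t2_space} \<Rightarrow> 'a"
  assumes "topological_vector_space scl"
    and C: "open C" "0 \<in> C" "convex_wrt scl C"
  obtains p where "sublinear scl p" "\<And>x. x \<in> C \<Longrightarrow> p x \<le> 1" "\<And>x. x \<notin> C \<Longrightarrow> 1 \<le> p x"
proof
  interpret topological_vector_space scl by fact
  interpret real_vector_space scl by unfold_locales
  define D where "D x = {t. t > 0 \<and> scl (inverse t) x \<in> C}" for x
  define p where "p x = Inf (D x)" for x
  have convexD: "scl u x + scl v y \<in> C" if "x \<in> C" "y \<in> C" "u \<ge> 0" "v \<ge> 0" "u + v = 1" for x y u v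
    using C(3) that unfolding convex_wrt_def by auto
  have D_nonempty: "D x \<noteq> {}" for x
  proof -
    \<comment> \<open>\<open>C\<close> absorbs \<open>x\<close>: since \<open>scl t x\<close> tends
      to \<open>0\<close>, some small positive \<open>t\<close> works, and its inverse lies in
      \<open>D x\<close>.\<close>
    have "continuous_on UNIV (\<lambda>t. scl t x)"
      by (intro continuous_intros)
    then have "isCont (\<lambda>t. scl t x) 0"
      by (simp add: continuous_on_eq_continuous_at)
    then have "((\<lambda>t. scl t x) \<longlongrightarrow> 0) (at 0)"
      by (simp add: isCont_def)
    then have "\<forall>\<^sub>F t in at 0. scl t x \<in> C"
      using C(1,2) by (rule topological_tendstoD)
    then have "\<forall>\<^sub>F t in at_right 0. scl t x \<in> C"
      by (simp add: eventually_at_split)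
    then have "\<forall>\<^sub>F t in at_right 0. scl t x \<in> C \<and> t > 0"
      by (intro eventually_conj eventually_at_right_less)
    then obtain t where "scl t x \<in> C" "t > 0"
      using eventually_happens'[OF trivial_limit_at_right_real] by blast
    then have "inverse t \<in> D x"
      by (simp add: D_def)
    then show ?thesis by auto
  qed
  have "bdd_below (D x)" for x
    by (intro bdd_belowI[where m = 0]) (auto simp: D_def)
  then have lower: "p x \<le> t" if "t \<in> D x" for x t
    using that unfolding p_def by (intro cInf_lower) auto
  have greatest: "m \<le> p x" if "\<And>t. t \<in> D x \<Longrightarrow> m \<le> t" for m x
    using that D_nonempty unfolding p_def by (intro cInf_greatest) auto
  show "sublinear scl p"
  proof (rule sublinearI)
    fix x y
    have *: "p (x + y) \<le> s + t" if "s \<in> D x" "t \<in> D y" for s t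
    proof (rule lower)
      have st: "s > 0" "t > 0" and mem: "scl (inverse s) x \<in> C" "scl (inverse t) y \<in> C"
        using that by (auto simp: D_def)
      \<comment> \<open>These convex weights cancel the inverses of \<open>s\<close> and
        \<open>t\<close>, leaving \<open>x + y\<close> scaled by
        \<open>inverse (s + t)\<close>.\<close>
      have "scl (s / (s + t)) (scl (inverse s) x) + scl (t / (s + t)) (scl (inverse t) y) \<in> C"
        using st mem by (intro convexD) (auto simp: add_divide_distrib[symmetric])
      also have "scl (s / (s + t)) (scl (inverse s) x) + scl (t / (s + t)) (scl (inverse t) y)
          = scl (inverse (s + t)) (x + y)"
        using st by (simp add: scale_right_distrib field_simps)
      finally show "s + t \<in> D (x + y)"
        using st by (simp add: D_def)
    qed
    have "p (x + y) - s \<le> p y" if "s \<in> D x" for s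
      using *[OF that] by (intro greatest) (simp add: algebra_simps)
    then have "p (x + y) - p y \<le> p x"
      by (intro greatest) (simp add: algebra_simps)
    then show "p (x + y) \<le> p x + p y" by simp
  next
    fix s x assume s: "(s::real) > 0"
    have "p (scl s x) / s \<le> t" if "t \<in> D x" for t
    proof -
      have "inverse (s * t) * s = inverse t"
        using s by (simp add: field_simps)
      then have "s * t \<in> D (scl s x)"
        using that s by (simp add: D_def del: inverse_mult_distrib)
      then show ?thesis
        using lower[of "s * t" "scl s x"] s by (simp add: field_simps)
    qed
    then have "p (scl s x) / s \<le> p x"
      by (rule greatest)
    then show "p (scl s x) \<le> s * p x"
      using s by (simp add: field_simps)
  qed
  show "p x \<le> 1" if "x \<in> C" for x
    using that by (intro lower) (simp add: D_def)
  show "1 \<le> p x" if "x \<notin> C" for x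
  proof (rule greatest, rule ccontr)
    fix t assume t: "t \<in> D x" and "\<not> 1 \<le> t"
    \<comment> \<open>For \<open>t < 1\<close> the point \<open>x\<close> is a convex combination of
      \<open>scl (inverse t) x\<close> and \<open>0\<close>, hence in \<open>C\<close>.\<close>
    then have "scl t (scl (inverse t) x) + scl (1 - t) 0 \<in> C"
      using C(2) by (intro convexD) (auto simp: D_def)
    then show False
      using that t by (simp add: D_def)
  qed
qed

lemma (in frechet_space) exists_convex_neighbourhood:
  assumes "x \<noteq> 0"
  obtains C where "open C" "0 \<in> C" "convex_wrt scl C" "x \<notin> C"
  using locally_convex[of "- {x}"] assms by auto

text \<open>A functional below the gauge of a convex neighbourhood missing \<open>x\<close>, and at
  least the gauge at \<open>x\<close>, has \<open>f x \<ge> 1\<close>. Being at most 1 on the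
  neighbourhood makes it continuous.\<close>

lemma real_functionals_separate_points:
  fixes scl :: "real \<Rightarrow> 'a::{uniform_topological_group_add, topological_ab_group_add, t2_space} \<Rightarrow> 'a"
  assumes "frechet_space scl" and "x \<noteq> 0"
  shows "\<exists>f\<in>continuous_functionals scl. f x \<noteq> 0"
proof -
  interpret frechet_space scl by fact
  interpret real_vector_space scl by unfold_locales
  obtain C where C: "open C" "0 \<in> C" "convex_wrt scl C" "x \<notin> C"
    using exists_convex_neighbourhood[OF \<open>x \<noteq> 0\<close>] .
  obtain p where p: "sublinear scl p" "\<And>x. x \<in> C \<Longrightarrow> p x \<le> 1" "\<And>x. x \<notin> C \<Longrightarrow> 1 \<le> p x"
    using Minkowski_functional[OF topological_vector_space_axioms C(1-3)] by blast
  obtain f where f: "Vector_Spaces.linear scl (*) f" "f \<le> p" "p x \<le> f x"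
    using Hahn_Banach_sublinear[OF p(1)] .
  interpret f: Vector_Spaces.linear scl "(*)" f by fact
  have upper: "f y \<le> 1" if "y \<in> C" for y
    using f(2) p(2)[OF that] by (auto simp: le_fun_def intro: order_trans)
  have "isCont f y" for y
    unfolding isCont_def
  proof (rule tendstoI)
    fix e :: real assume e: "e > 0"
    \<comment> \<open>The factor 2 turns the bound 1 on \<open>C\<close> into \<open>e / 2\<close>,
      strictly below \<open>e\<close>.\<close>
    define c where "c = 2 / e"
    \<comment> \<open>Both differences are tested because \<open>C\<close> may fail to be
      symmetric.\<close>
    have "open ((\<lambda>z. scl c (z - y)) -` C)" "open ((\<lambda>z. scl c (y - z)) -` C)"
      by (intro open_vimage C(1) continuous_intros)+
    then have "\<forall>\<^sub>F z in nhds y. z \<in> (\<lambda>z. scl c (z - y)) -` C"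
        "\<forall>\<^sub>F z in nhds y. z \<in> (\<lambda>z. scl c (y - z)) -` C"
      using C(2) by (auto intro!: eventually_nhds_in_open simp del: vimage_eq simp: vimage_eq[of y])
    then have "\<forall>\<^sub>F z in nhds y. dist (f z) (f y) < e"
    proof eventually_elim
      case (elim z)
      then have "c * (f z - f y) \<le> 1" "c * (f y - f z) \<le> 1"
        using upper[of "scl c (z - y)"] upper[of "scl c (y - z)"] by (simp_all add: f.scale f.diff)
      then have "f z - f y \<le> e / 2" "f y - f z \<le> e / 2"
        using e by (simp_all add: c_def field_simps)
      then show ?case
        using e by (simp add: dist_real_def abs_le_iff)
    qed
    then show "\<forall>\<^sub>F z in at y. dist (f z) (f y) < e"
      by (simp add: eventually_nhds_conv_at)
  qed
  then have "f \<in> continuous_functionals scl"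
    using f(1) by (simp add: continuous_functionals_def continuous_on_eq_continuous_at)
  moreover have "f x \<noteq> 0"
    using f(3) p(3)[OF C(4)] by simp
  ultimately show ?thesis by auto
qed

section \<open>From real to complex scalars\<close>

lemma frechet_space_restrict_scalars:
  fixes scl :: "'k::real_normed_field \<Rightarrow>
    'a::{uniform_topological_group_add, topological_ab_group_add, t2_space} \<Rightarrow> 'a"
  assumes "frechet_space scl"
  shows "frechet_space (\<lambda>r::real. scl (of_real r))"
proof -
  interpret frechet_space scl by fact
  \<comment> \<open>Convexity involves only scalars \<open>of_real u\<close>, so it survives the
    restriction.\<close>
  have *: "convex_wrt (\<lambda>r::real. scl (of_real r)) C = convex_wrt scl C" for C
    by (simp add: convex_wrt_def)
  show ?thesis
  proof unfold_locales
    show "continuous_on UNIV (\<lambda>(c::real, x). scl (of_real c) x)"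
      by (simp add: case_prod_beta) (intro continuous_intros)
    show "\<exists>C. open C \<and> 0 \<in> C \<and> convex_wrt (\<lambda>r::real. scl (of_real r)) C \<and> C \<subseteq> U"
      if "open U" "0 \<in> U" for U
      unfolding * using locally_convex that by blast
  qed (auto simp: scale_right_distrib scale_left_distrib metrizable complete_UNIV)
qed

text \<open>A real functional \<open>u\<close> with \<open>u x \<noteq> 0\<close> is the real part
  of the complex functional \<open>u y - \<i> * u (scl \<i> y)\<close>.\<close>

lemma complex_functionals_separate_points:
  fixes scl :: "complex \<Rightarrow> 'a::{uniform_topological_group_add, topological_ab_group_add, t2_space} \<Rightarrow> 'a"
  assumes "frechet_space scl" and "x \<noteq> 0"
  shows "\<exists>f\<in>continuous_functionals scl. f x \<noteq> 0"
proof -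
  interpret frechet_space scl by fact
  obtain u where u: "u \<in> continuous_functionals (\<lambda>r. scl (of_real r))" "u x \<noteq> 0"
    using real_functionals_separate_points[OF frechet_space_restrict_scalars] assms by blast
  interpret u: Vector_Spaces.linear "\<lambda>r. scl (of_real r)" "(*)" u
    using u(1) by (simp add: continuous_functionals_def)
  have cont_u: "continuous_on UNIV u"
    using u(1) by (simp add: continuous_functionals_def)
  define f where "f y = Complex (u y) (- u (scl \<i> y))" for y
  interpret vector_space_pair scl "(*)" by unfold_locales
  have "Vector_Spaces.linear scl (*) f"
  proof (rule linearI)
    fix y z show "f (y + z) = f y + f z"
      by (simp add: f_def u.add scale_right_distrib complex_eq_iff)
  next
    fix c y
    have u_scl: "u (scl c y) = Re c * u y + Im c * u (scl \<i> y)" for c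
    proof -
      have "scl c y = scl (of_real (Re c)) y + scl (of_real (Im c)) (scl \<i> y)"
        by (simp add: scale_left_distrib[symmetric] complex_eq_iff)
      then show ?thesis
        by (simp only: u.add u.scale)
    qed
    show "f (scl c y) = c * f y"
      \<comment> \<open>The factor \<open>c\<close> settles the real part, \<open>\<i> * c\<close>
        the imaginary part.\<close>
      using u_scl[of c] u_scl[of "\<i> * c"] by (simp add: f_def complex_eq_iff)
  qed
  moreover have "continuous_on UNIV f"
    unfolding f_def Complex_eq
    by (intro continuous_intros continuous_on_compose2[OF cont_u]) auto
  moreover have "f x \<noteq> 0"
    using u(2) by (simp add: f_def complex_eq_iff)
  ultimately show ?thesis
    by (auto simp: continuous_functionals_def)
qed

section \<open>Operators of rank one\<close>

text \<open>The image of a finite spanning set of \<open>V\<close> would be a finite spanning set of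
  \<open>W\<close>.\<close>

lemma infinite_dimensional_linear_image:
  assumes "Vector_Spaces.linear s1 s2 g" and "g ` V = W" and "infinite_dimensional s2 W"
  shows "infinite_dimensional s1 V"
proof -
  interpret Vector_Spaces.linear s1 s2 g by fact
  show ?thesis
    using assms(2,3) span_image finite_imageI unfolding infinite_dimensional_def by metis
qed

text \<open>Common ground of the real and the complex case: once points are separated, the argument
  is uniform in the scalar field.\<close>

locale separated_vector_space = topological_vector_space scl
  for scl :: "'k::real_normed_field \<Rightarrow>
    'a::{uniform_topological_group_add, topological_ab_group_add, t2_space} \<Rightarrow> 'a" +
  assumes separating: "x \<noteq> 0 \<Longrightarrow> \<exists>f\<in>continuous_functionals scl. f x \<noteq> 0"
begin

section \<open>Finite-dimensional subspaces\<close>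

lemma obtain_functional:
  assumes "x \<noteq> 0"
  obtains f where "Vector_Spaces.linear scl (*) f" "continuous_on UNIV f" "f x = 1"
proof -
  obtain f where f: "Vector_Spaces.linear scl (*) f" "continuous_on UNIV f" "f x \<noteq> 0"
    using separating[OF assms] by (auto simp: continuous_functionals_def)
  interpret f: Vector_Spaces.linear scl "(*)" f by fact
  interpret vector_space_pair scl "(*)" by unfold_locales
  have "Vector_Spaces.linear scl (*) (\<lambda>y. f y / f x)"
    by (rule linearI) (auto simp: f.add f.scale add_divide_distrib)
  moreover have "continuous_on UNIV (\<lambda>y. f y / f x)"
    using f by (intro continuous_intros) auto
  ultimately show ?thesis
    using f(3) that by simp
qed

text \<open>Induction on \<open>B\<close>: a new vector \<open>w\<close> adds to \<open>P\<close> a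
  rank one term in the direction \<open>z = w - P w\<close>. The projection exhibits
  \<open>span B\<close> as a closed fixed point set.\<close>

lemma exists_projection_finite_span:
  assumes "finite B"
  shows "\<exists>P. P \<in> continuous_operators scl \<and> range P \<subseteq> span B \<and> (\<forall>v\<in>span B. P v = v)"
  using assms
proof (induction B)
  case empty
  interpret vector_space_pair scl scl by unfold_locales
  show ?case
    by (intro exI[of _ "\<lambda>_. 0"]) (auto simp: continuous_operators_def linear_zero)
next
  case (insert w B)
  then obtain P where P: "Vector_Spaces.linear scl scl P" "continuous_on UNIV P"
    "\<And>v. P v \<in> span B" "\<And>v. v \<in> span B \<Longrightarrow> P v = v"
    by (auto simp: continuous_operators_def)
  interpret P: Vector_Spaces.linear scl scl P by fact
  show ?case
  proof (cases "w \<in> span B")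
    case True
    then have "span (insert w B) = span B"
      by (rule span_redundant)
    then show ?thesis
      using insert.IH by simp
  next
    case False
    define z where "z = w - P w"
    have "z \<noteq> 0"
      using False P(3)[of w] by (auto simp: z_def)
    then obtain g where g: "Vector_Spaces.linear scl (*) g" "continuous_on UNIV g" "g z = 1"
      using obtain_functional by blast
    interpret g: Vector_Spaces.linear scl "(*)" g by fact
    \<comment> \<open>On \<open>span (insert w B)\<close> the remainder \<open>v - P v\<close> is a
      multiple of \<open>z\<close>, which \<open>g\<close> reproduces because
      \<open>g z = 1\<close>.\<close>
    define Q where "Q v = P v + scl (g (v - P v)) z" for v
    have span_mono: "span B \<subseteq> span (insert w B)"
      by (rule span_mono) auto
    have "z \<in> span (insert w B)"
      unfolding z_def using span_mono P(3)[of w] span_base[of w "insert w B"]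
      by (intro span_diff) auto
    then have "range Q \<subseteq> span (insert w B)"
      using span_mono P(3) by (auto simp: Q_def intro!: span_add span_scale)
    moreover have "Q v = v" if v: "v \<in> span (insert w B)" for v
    proof -
      obtain c where "v - scl c w \<in> span B"
        using span_breakdown[of w "insert w B" v] v insert.hyps by auto
      then have "P (v - scl c w) = v - scl c w"
        by (rule P(4))
      then have eq: "v - P v = scl c z"
        by (simp add: z_def P.diff P.scale scale_right_diff_distrib algebra_simps)
      have "Q v = P v + scl c z"
        using g(3) by (simp add: Q_def eq g.scale)
      then show ?thesis
        by (simp flip: eq)
    qed
    moreover have "Q \<in> continuous_operators scl"
    proof -
      interpret pair: vector_space_pair scl scl by unfold_locales
      have "Vector_Spaces.linear scl scl Q"
        by (rule pair.linearI)
          (simp_all add: Q_def P.add P.scale P.diff g.add g.scale g.diff algebra_simps)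
      moreover have "continuous_on UNIV Q"
        unfolding Q_def
        by (intro continuous_intros P(2) continuous_on_compose2[OF g(2)]) auto
      ultimately show ?thesis
        by (simp add: continuous_operators_def)
    qed
    ultimately show ?thesis
      by blast
  qed
qed

lemma closed_span_finite:
  assumes "finite B"
  shows "closed (span B)"
proof -
  obtain P where P: "continuous_on UNIV P" "range P \<subseteq> span B" "\<And>v. v \<in> span B \<Longrightarrow> P v = v"
    using exists_projection_finite_span[OF assms] by (auto simp: continuous_operators_def)
  have "span B = {v. P v = v}"
    using P(2,3) by (auto simp: image_subset_iff) metis
  then show ?thesis
    using P(1) by (simp add: closed_Collect_eq)
qed

text \<open>The closed set \<open>span B\<close> contains the closure of \<open>A\<close>, so
  density would make the space finite-dimensional.\<close>

lemma dense_not_subset_finite_span: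
  assumes "infinite_dimensional scl UNIV" "finite B" "A \<subseteq> span B"
  shows "closure A \<noteq> UNIV"
proof
  assume "closure A = UNIV"
  then have "span B = UNIV"
    using closure_minimal[OF assms(3) closed_span_finite[OF assms(2)]] by auto
  then show False
    using assms(1,2) by (auto simp: infinite_dimensional_def)
qed

section \<open>Spaceability through rank one operators\<close>

theorem spaceable_non_dense_cyclic_injective:
  assumes inf: "infinite_dimensional scl UNIV"
  shows "spaceable (operator_scale scl) (strong_operator_top scl)
    (continuous_operators scl -
      (dense_range_operators scl \<union> cyclic_operators scl \<union> injective_operators scl))"
proof -
  interpret op: vector_space "operator_scale scl"
    by (rule vector_space_operator_scale) unfold_locales
  have proper: "\<exists>x. x \<notin> span B" if "finite B" for B
    using inf that by (auto simp: infinite_dimensional_def)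
  obtain e :: 'a where "e \<noteq> 0"
    using proper[of "{}"] by auto
  then obtain f where f: "Vector_Spaces.linear scl (*) f" "continuous_on UNIV f" "f e = 1"
    using obtain_functional by blast
  interpret f: Vector_Spaces.linear scl "(*)" f by fact
  define R where "R w = (\<lambda>x. scl (f x) w)" for w
  have R_operator: "R w \<in> continuous_operators scl" for w
  proof -
    interpret pair: vector_space_pair scl scl by unfold_locales
    have "Vector_Spaces.linear scl scl (R w)"
      by (rule pair.linearI) (simp_all add: R_def f.add f.scale scale_left_distrib)
    moreover have "continuous_on UNIV (R w)"
      unfolding R_def by (intro continuous_intros f(2))
    ultimately show ?thesis
      by (simp add: continuous_operators_def)
  qed
  have linear_R: "Vector_Spaces.linear scl (operator_scale scl) R"
  proof -
    interpret vector_space_pair scl "operator_scale scl" by unfold_locales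
    show ?thesis
      by (rule linearI)
        (auto simp: R_def operator_scale_def fun_eq_iff scale_right_distrib mult.commute)
  qed
  interpret R: Vector_Spaces.linear scl "operator_scale scl" R by fact
  \<comment> \<open>As \<open>f e = 1\<close>, evaluation at \<open>e\<close> recovers
    \<open>w\<close> from \<open>R w\<close>. Membership becomes a family of equations between point
    evaluations, which are continuous for pointwise convergence.\<close>
  have range_R: "range R = {T \<in> continuous_operators scl. \<forall>x. T x = scl (f x) (T e)}"
  proof (intro set_eqI iffI)
    fix T assume "T \<in> {T \<in> continuous_operators scl. \<forall>x. T x = scl (f x) (T e)}"
    then have "T = R (T e)"
      unfolding R_def by blast
    then show "T \<in> range R" by blast
  next
    fix T assume "T \<in> range R"
    then obtain w where T: "T = R w" by blast
    have "R w x = scl (f x) (R w e)" for x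
      using f(3) by (simp add: R_def)
    then show "T \<in> {T \<in> continuous_operators scl. \<forall>x. T x = scl (f x) (T e)}"
      using R_operator unfolding T by blast
  qed
  have "op.subspace (range R)"
    by (intro R.subspace_image subspace_UNIV)
  moreover have "closedin (strong_operator_top scl) (range R)"
  proof -
    have "closed {T. \<forall>x. T x = scl (f x) (T e)}"
      by (intro closed_Collect_all closed_Collect_eq continuous_intros) auto
    moreover have "range R = continuous_operators scl \<inter> {T. \<forall>x. T x = scl (f x) (T e)}"
      unfolding range_R by blast
    ultimately show ?thesis
      unfolding strong_operator_top_def by (simp only: closedin_closed_Int)
  qed
  moreover have "infinite_dimensional (operator_scale scl) (range R)"
  \<comment> \<open>Evaluation at \<open>e\<close> maps \<open>range R\<close> onto the whole
    space.\<close>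
  proof (rule infinite_dimensional_linear_image[OF _ _ inf])
    interpret vector_space_pair "operator_scale scl" scl by unfold_locales
    show "Vector_Spaces.linear (operator_scale scl) scl (\<lambda>T. T e)"
      by (rule linearI) (auto simp: operator_scale_def)
    show "(\<lambda>T. T e) ` range R = UNIV"
      using f(3) by (simp add: R_def image_image)
  qed
  moreover have "T \<in> continuous_operators scl -
      (dense_range_operators scl \<union> cyclic_operators scl \<union> injective_operators scl)"
    if "T \<in> range R" "T \<noteq> 0" for T
  proof -
    from that obtain w where T: "T = R w" by blast
    have T_apply: "T x = scl (f x) w" for x
      by (simp add: T R_def)
    have "range T \<subseteq> span {w}"
      using span_base[of w "{w}"] by (auto simp: T_apply intro: span_scale)
    then have "T \<notin> dense_range_operators scl"
      using dense_not_subset_finite_span[OF inf, of "{w}"] by (auto simp: dense_range_operators_def)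
    moreover have "T \<notin> cyclic_operators scl"
    proof -
      \<comment> \<open>Power 0 gives \<open>x\<close>; every later power ends with an application
        of \<open>T\<close>, hence is a multiple of \<open>w\<close>.\<close>
      have "(T ^^ n) x \<in> span {x, w}" for n x
        using span_base[of x "{x, w}"] span_base[of w "{x, w}"]
        by (cases n) (auto simp: T_apply intro: span_scale)
      then have "span (range (\<lambda>n. (T ^^ n) x)) \<subseteq> span {x, w}" for x
        by (intro span_minimal) auto
      then have "closure (span (range (\<lambda>n. (T ^^ n) x))) \<noteq> UNIV" for x
        by (intro dense_not_subset_finite_span[OF inf, of "{x, w}"]) auto
      then show ?thesis
        by (simp add: cyclic_operators_def)
    qed
    moreover have "T \<notin> injective_operators scl"
    proof -
      \<comment> \<open>Outside the line of \<open>e\<close>, subtracting \<open>scl (f x) e\<close>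
        leaves a nonzero vector in the kernel of \<open>f\<close>.\<close>
      obtain x where "x \<notin> span {e}"
        using proper by blast
      then have "x - scl (f x) e \<noteq> 0"
        by (metis eq_iff_diff_eq_0 insertI1 span_base span_scale)
      moreover have "T (x - scl (f x) e) = T 0"
        using f(3) by (simp add: T_apply f.diff f.scale)
      ultimately have "\<not> inj T"
        unfolding inj_def by blast
      then show ?thesis
        by (simp add: injective_operators_def)
    qed
    ultimately show ?thesis
      using R_operator T by blast
  qed
  ultimately show ?thesis
    unfolding spaceable_def by blast
qed

end

text \<open>The conjuncts are the two choices of the scalar field; each supplies its own separation
  of points to the common theorem.\<close>

theorem theorem3p3:
  shows "(\<forall>scl :: real \<Rightarrow> 'a \<Rightarrow>
            'a::{uniform_topological_group_add, topological_ab_group_add, t2_space}.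
           frechet_space scl \<and> infinite_dimensional scl UNIV \<longrightarrow>
           spaceable (operator_scale scl) (strong_operator_top scl)
             (continuous_operators scl -
               (dense_range_operators scl \<union> cyclic_operators scl \<union> injective_operators scl)))
       \<and> (\<forall>scl :: complex \<Rightarrow> 'a \<Rightarrow> 'a.
           frechet_space scl \<and> infinite_dimensional scl UNIV \<longrightarrow>
           spaceable (operator_scale scl) (strong_operator_top scl)
             (continuous_operators scl -
               (dense_range_operators scl \<union> cyclic_operators scl \<union> injective_operators scl)))"
proof (intro conjI allI impI)
  fix scl :: "real \<Rightarrow> 'a \<Rightarrow> 'a"
  assume "frechet_space scl \<and> infinite_dimensional scl UNIV"
  then interpret frechet_space scl by simp
  interpret separated_vector_space scl
    by unfold_locales (rule real_functionals_separate_points[OF frechet_space_axioms])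
  show "spaceable (operator_scale scl) (strong_operator_top scl)
      (continuous_operators scl -
        (dense_range_operators scl \<union> cyclic_operators scl \<union> injective_operators scl))"
    using \<open>_ \<and> _\<close> by (intro spaceable_non_dense_cyclic_injective) simp
next
  fix scl :: "complex \<Rightarrow> 'a \<Rightarrow> 'a"
  assume "frechet_space scl \<and> infinite_dimensional scl UNIV"
  then interpret frechet_space scl by simp
  interpret separated_vector_space scl
    by unfold_locales (rule complex_functionals_separate_points[OF frechet_space_axioms])
  show "spaceable (operator_scale scl) (strong_operator_top scl)
      (continuous_operators scl -
        (dense_range_operators scl \<union> cyclic_operators scl \<union> injective_operators scl))"
    using \<open>_ \<and> _\<close> by (intro spaceable_non_dense_cyclic_injective) simp
qed

end
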